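(* Let $4\le d\le 14$ and let $f(z)=b(z)\prod_{i=0}^{\lfloor d/2\rfloor-1}(z^2+z+c_i)$ be a $CL$-polynomial of degree $d$. Let $\mathbf{v}=(v_1,\dots,v_{\lfloor d/2\rfloor})$, where $v_l$ is the $l$-th elementary symmetric polynomial in $c_0,\dots,c_{\lfloor d/2\rfloor-1}$, and let $\langle\cdot,\cdot\rangle$ be the standard scalar product. Then $f$ satisfies $(\diamondsuit)$ if and only if all the inequalities listed below for its degree $d$ hold; in particular, in that case $\mathbf{v}$ lies in the convex hull of the points listed for $d$. $d=4$: $\langle(0,1),\mathbf v\rangle\ge0$; $\langle(1,-2),\mathbf v\rangle+2\ge0$; $\langle(-2,3),\mathbf v\rangle+8\ge0$. Points: $(22,12)$, $(4,0)$, $(-2,0)$. $d=5$: $\langle(0,1),\mathbf v\rangle\ge0$; $\langle(2,-1),\mathbf v\rangle+4\ge0$; $\langle(-3,1),\mathbf v\rangle+54\ge0$. Points: $(58,120)$, $(18,0)$, $(-2,0)$. $d=6$: $\langle(0,0,1),\mathbf v\rangle\ge0$; $\langle(2,1,-3),\mathbf v\rangle+4\ge0$; $\langle(8,-8,15),\mathbf v\rangle+160\ge0$; $\langle(-6,3,-5),\mathbf v\rangle+96\ge0$. Points: $(127,822,360)$, $(52,72,0)$, $(7,-18,0)$, $(-8,12,0)$. $d=7$: $\langle(0,0,1),\mathbf v\rangle\ge0$; $\langle(12,6,-5),\mathbf v\rangle+24\ge0$; $\langle(28,-6,3),\mathbf v\rangle+296\ge0$; $\langle(-96,12,-5),\mathbf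 v\rangle+4128\ge0$. Points: $(244,3708,5040)$, $(118,600,0)$, $(34,-72,0)$, $(-8,12,0)$. $d=8$: $\langle(0,0,0,1),\mathbf v\rangle\ge0$; $\langle(4,2,1,-4),\mathbf v\rangle+8\ge0$; $\langle(36,0,-3,7),\mathbf v\rangle+288\ge0$; $\langle(36,-18,15,-28),\mathbf v\rangle+4824\ge0$; $\langle(-224,32,-20,35),\mathbf v\rangle+9344\ge0$. Points: $(428,13324,52272,20160)$, $(232,3132,2880,0)$, $(92,52,-480,0)$, $(8,-116,192,0)$, $(-20,108,-144,0)$. $d=9$: $\langle(0,0,0,1),\mathbf v\rangle\ge0$; $\langle(24,12,6,-7),\mathbf v\rangle+48\ge0$; $\langle(84,6,-3,2),\mathbf v\rangle+600\ge0$; $\langle(1188,-126,27,-14),\mathbf v\rangle+41256\ge0$; $\langle(-1620,90,-15,7),\mathbf v\rangle+137160\ge0$. Points: $(700,39708,341136,362880)$, $(412,11772,35280,0)$, $(196,1404,-3600,0)$, $(52,-468,720,0)$, $(-20,108,-144,0)$. $d=10$: $\langle(0,0,0,0,1),\mathbf v\rangle\ge0$; $\langle(8,4,2,1,-5),\mathbf v\rangle+16\ge0$; $\langle(1120,128,-8,-16,45),\mathbf v\rangle+7424\ge0$; $\langle(920,-26,-4,7,-15),\mathbf v\rangle+20632\ge0$; $\langle(272,-224,68,-56,105),\mathbf v\rangle+442624\ge0$; $\langle(-4520,260,-50,35,-63),\mathbf v\rangle+378320\ge0$. Points: $(1085,104008,1757196,5132880,1814400)$, $(680,36508,277056,201600,0)$,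 $(365,7528,-3924,-25200,0)$, $(140,-572,-3024,7200,0)$, $(5,-392,2556,-3600,0)$, $(-40,508,-2304,2880,0)$. $d=11$: $\langle(0,0,0,0,1),\mathbf v\rangle\ge0$; $\langle(16,8,4,2,-3),\mathbf v\rangle+32\ge0$; $\langle(5904,792,36,-42,35),\mathbf v\rangle+37728\ge0$; $\langle(4704,48,-24,8,-5),\mathbf v\rangle+85440\ge0$; $\langle(19216,-1192,124,-28,15),\mathbf v\rangle+1740512\ge0$; $\langle(-31968,936,-72,14,-7),\mathbf v\rangle+4692384\ge0$. Points: $(1610,244708,7272216,44339040,39916800)$, $(1060,97308,1494576,3265920,0)$, $(620,26908,84816,-282240,0)$, $(290,1828,-30024,50400,0)$, $(70,-1692,9576,-12960,0)$, $(-40,508,-2304,2880,0)$. $d=12$: $\langle(0,0,0,0,0,1),\mathbf v\rangle\ge0$; $\langle(16,8,4,2,1,-6),\mathbf v\rangle+32\ge0$; $\langle(3680,544,56,-8,-10,33),\mathbf v\rangle+22912\ge0$; $\langle(75120,2568,-228,-6,45,-110),\mathbf v\rangle+1192224\ge0$; $\langle(187520,-4352,32,64,-80,165),\mathbf v\rangle+9601024\ge0$; $\langle(-7680,-984,144,-42,35,-66),\mathbf v\rangle+9717408\ge0$; $\langle(-104672,3104,-248,56,-42,77),\mathbf v\rangle+15276416\ge0$. Points: $(2306,530368,25971144,302788656,723263040,239500800)$, $(1580,232708,6523056,34999200,21772800,0)$, $(986,78268,804024,-840384,-2177280,0)$, $(524,13588,-95952,-108576,483840,0)$, $(194,-2912,-2232,105264,-181440,0)$,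 $(-4,-932,15984,-80064,103680,0)$, $(-70,1708,-17544,72000,-86400,0)$. $d=13$: $\langle(0,0,0,0,0,1),\mathbf v\rangle\ge0$; $\langle(96,48,24,12,6,-11),\mathbf v\rangle+192\ge0$; $\langle(6256,968,124,2,-9,9),\mathbf v\rangle+38432\ge0$; $\langle(86160,4200,-60,-30,15,-11),\mathbf v\rangle+1260960\ge0$; $\langle(1583520,-3984,-1560,300,-90,55),\mathbf v\rangle+60906432\ge0$; $\langle(2849920,-117280,6880,-760,180,-99),\mathbf v\rangle+590783360\ge0$; $\langle(-1475936,25592,-1064,98,-21,11),\mathbf v\rangle+344354528\ge0$. Points: $(3206,1071868,81406344,1627117056,7827719040,6227020800)$, $(2270,508708,23753736,249815520,439084800,0)$, $(1490,196708,4275576,6979680,-32659200,0)$, $(866,50068,-22536,-2702304,5080320,0)$, $(398,148,-123000,847008,-1209600,0)$, $(86,-4532,61704,-287424,362880,0)$, $(-70,1708,-17544,72000,-86400,0)$. $d=14$: $\langle(0,0,0,0,0,0,1),\mathbf v\rangle\ge0$; $\langle(32,16,8,4,2,1,-7),\mathbf v\rangle+64\ge0$; $\langle(45696,7296,1056,96,-24,-24,91),\mathbf v\rangle+278016\ge0$; $\langle(573216,33888,744,-168,6,33,-91),\mathbf v\rangle+7911552\ge0$; $\langle(24080000,269440,-22240,1120,200,-440,1001),\mathbf v\rangle+771857920\ge0$; $\langle(30693600,-533520,9720,540,-450,495,-1001),\mathbf v\rangle+3152571840\ge0$; $\langle(-7032576,-169728,15936,-2112,624,-528,1001),\mathbf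 v\rangle+6989196288\ge0$; $\langle(-5559008,96992,-4088,392,-98,77,-143),\mathbf v\rangle+1292719232\ge0$. Points: $(4347,2046870,231190132,7475341368,67360465152,138619313280,43589145600)$, $(3164,1036588,76136688,1431621504,6044647680,3353011200,0)$, $(2163,445998,17610220,114649848,-163634400,-279417600,0)$, $(1344,142968,1436608,-15125616,-2062080,50803200,0)$, $(707,19390,-492228,1431288,6560352,-15240960,0)$, $(252,-8820,51952,524928,-4578048,6773760,0)$, $(-21,-1722,66148,-787656,3441600,-4233600,0)$, $(-112,4648,-89280,808848,-3110400,3628800,0)$.
   Context: A $CL$-polynomial of degree $d$ is a polynomial of the form $f(z)=b(z)\prod_{i=0}^{\lfloor d/2\rfloor-1}(z^2+z+c_i)$, where the $c_i$ are real numbers $\geq\frac14$ and, for a non-zero constant $a$, $b(z)=a$ if $d$ is even and $b(z)=a(2z+1)$ if $d$ is odd. For a polynomial $f$ of degree $d$, the $h^*$-polynomial is the polynomial $h^*(t)=\sum_{i=0}^d h^*_i t^i$ with $\sum_{k\ge 0} f(k)t^k=\frac{h^*(t)}{(1-t)^{d+1}}$; equivalently $f(z)=\sum_{i=0}^d h_i^*\binom{z+d-i}{d}$. Property $(\diamondsuit)$ means that the coefficients of the $h^*$-polynomial of $f$ are palindromic (that is, $h^*_i=h^*_{d-i}$ for all $0\le i\le d$) and non-negative.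
   Formalization: The condition a > 0 is added next to the listed inequalities in the equivalence: for a < 0 the claim fails as stated (d = 4, a = −1, c_0 = c_1 = 1/4 satisfies all the inequalities, but h*_0 = f(0) < 0). *)

theory Defs
  imports
    "HOL-Analysis.Analysis"
    "HOL-Computational_Algebra.Polynomial_FPS"
begin

definition cl_poly :: "nat \<Rightarrow> real \<Rightarrow> (nat \<Rightarrow> real) \<Rightarrow> real poly" where
  "cl_poly d a c =
     (if even d then [:a:] else smult a [:1, 2:]) * (\<Prod>i<d div 2. [:c i, 1, 1:])"

definition elem_sym :: "nat \<Rightarrow> (nat \<Rightarrow> real) \<Rightarrow> nat \<Rightarrow> real" where
  "elem_sym m c l = (\<Sum>S | S \<subseteq> {..<m} \<and> card S = l. \<Prod>i\<in>S. c i)"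

definition hstar_poly :: "real poly \<Rightarrow> real poly" where
  "hstar_poly f = (THE h. degree h \<le> degree f \<and>
     Abs_fps (\<lambda>k. poly f (of_nat k)) = fps_of_poly h / (1 - fps_X) ^ (degree f + 1))"

definition diamond :: "real poly \<Rightarrow> bool" where
  "diamond f \<longleftrightarrow>
     (\<forall>i\<le>degree f. coeff (hstar_poly f) i = coeff (hstar_poly f) (degree f - i)) \<and>
     (\<forall>i\<le>degree f. 0 \<le> coeff (hstar_poly f) i)"

text \<open>The description in \<open>hstar_poly\<close> is proper: such a polynomial exists and is unique.\<close>

lemma degree_backward_diff:
  fixes p :: "real poly"
  assumes "degree p \<le> Suc n"
  shows "degree (p - pcompose p [:-1, 1:]) \<le> n"
proof (cases "degree p = 0")
  case True
  then obtain x where "p = [:x:]" by (rule degree_eq_zeroE)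
  then show ?thesis by (simp add: pcompose_pCons)
next
  case False
  have deg: "degree (pcompose p [:-1, 1:]) = degree p" by (simp add: degree_pcompose)
  have lc: "lead_coeff (pcompose p [:-1, 1:]) = lead_coeff p"
    by (subst lead_coeff_comp) auto
  have "degree (p - pcompose p [:-1, 1:]) < degree p"
  proof (rule degree_lessI)
    show "\<forall>k\<ge>degree p. coeff (p - pcompose p [:-1, 1:]) k = 0"
    proof (intro allI impI)
      fix k assume "degree p \<le> k"
      then consider "k = degree p" | "k > degree p" by linarith
      then show "coeff (p - pcompose p [:-1, 1:]) k = 0"
      proof cases
        case 1
        then show ?thesis using lc deg by simp
      next
        case 2
        then show ?thesis using deg by (simp add: coeff_eq_0)
      qed
    qed
  qed (use False in auto)
  with assms show ?thesis by simp
qed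

lemma hstar_exists_aux:
  fixes p :: "real poly"
  assumes "degree p \<le> n"
  shows "\<exists>h. degree h \<le> n \<and>
    fps_of_poly h = Abs_fps (\<lambda>k. poly p (of_nat k)) * (1 - fps_X) ^ (n + 1)"
  using assms
proof (induction n arbitrary: p)
  case 0
  then obtain x where p: "p = [:x:]" by (auto elim: degree_eq_zeroE)
  have "fps_of_poly [:x:] = Abs_fps (\<lambda>k. poly p (of_nat k)) * (1 - fps_X)"
    by (rule fps_ext) (auto simp: p algebra_simps fps_of_poly_const)
  then show ?case by (intro exI[of _ "[:x:]"]) simp
next
  case (Suc n)
  define q where "q = p - pcompose p [:-1, 1:]"
  have "degree q \<le> n" unfolding q_def using Suc.prems by (rule degree_backward_diff)
  from Suc.IH[OF this] obtain h where h: "degree h \<le> n"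
    "fps_of_poly h = Abs_fps (\<lambda>k. poly q (of_nat k)) * (1 - fps_X) ^ (n + 1)" by blast
  define h' where "h' = h + smult (poly p (-1)) ([:1, -1:] ^ (n + 1))"
  have "degree ([:1, -1:] ^ (n + 1) :: real poly) \<le> Suc n"
    using degree_power_le[of "[:1, -1:] :: real poly" "n + 1"] by simp
  then have deg: "degree h' \<le> Suc n"
    unfolding h'_def using h(1)
    by (intro degree_add_le order.trans[OF degree_smult_le]) auto
  have step: "Abs_fps (\<lambda>k. poly p (of_nat k)) * (1 - fps_X) =
      Abs_fps (\<lambda>k. poly q (of_nat k)) + fps_const (poly p (-1))"
  proof (rule fps_ext)
    fix k
    show "fps_nth (Abs_fps (\<lambda>k. poly p (of_nat k)) * (1 - fps_X)) k =
      fps_nth (Abs_fps (\<lambda>k. poly q (of_nat k)) + fps_const (poly p (-1))) k"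
      by (cases k) (auto simp: q_def algebra_simps poly_pcompose)
  qed
  have lin: "fps_of_poly [:1, -1:] = (1 - fps_X :: real fps)"
    by (rule fps_ext) (auto simp: coeff_pCons fps_X_def split: nat.splits)
  have "fps_of_poly h' =
      (Abs_fps (\<lambda>k. poly q (of_nat k)) + fps_const (poly p (-1))) * (1 - fps_X) ^ (n + 1)"
    unfolding h'_def
    by (simp only: fps_of_poly_add fps_of_poly_smult fps_of_poly_power lin h(2) distrib_right)
  also have "\<dots> = Abs_fps (\<lambda>k. poly p (of_nat k)) * (1 - fps_X) ^ (Suc n + 1)"
    by (simp add: step[symmetric] mult_ac)
  finally show ?case using deg by blast
qed

lemma hstar_poly_ex1:
  "\<exists>!h. degree h \<le> degree f \<and>
     Abs_fps (\<lambda>k. poly f (of_nat k)) = fps_of_poly h / (1 - fps_X) ^ (degree f + 1)"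
  for f :: "real poly"
proof -
  define u :: "real fps" where "u = (1 - fps_X) ^ (degree f + 1)"
  have u: "fps_nth u 0 \<noteq> 0" unfolding u_def by (simp add: fps_nth_power_0)
  have inv: "inverse u * u = 1" using u by (rule inverse_mult_eq_1)
  have eq: "F = G / u \<longleftrightarrow> G = F * u" for F G :: "real fps"
  proof -
    have "G / u = G * inverse u" using u by (rule fps_divide_unit)
    moreover have "G * inverse u * u = G" "F * u * inverse u = F"
      using inv by (simp_all add: mult.assoc mult.commute[of u])
    ultimately show ?thesis by metis
  qed
  obtain h where "degree h \<le> degree f" "fps_of_poly h = Abs_fps (\<lambda>k. poly f (of_nat k)) * u"
    using hstar_exists_aux[of f "degree f"] unfolding u_def by auto
  then show ?thesis
    unfolding u_def[symmetric] eq by (metis fps_of_poly_eq_iff)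
qed

end

theory Submission
  imports Defs
begin

text \<open>
  Writing \<open>m = \<lfloor>d / 2\<rfloor>\<close>, a \<open>CL\<close>-polynomial is \<open>a \<Sum>\<^sub>l v\<^sub>l b(z) (z\<^sup>2 + z)\<^sup>m\<^sup>-\<^sup>l\<close> (with \<open>v\<^sub>0 = 1\<close>), so each
  \<open>h\<^sup>*\<^sub>k\<close> is \<open>a\<close> times an affine form in \<open>v\<close> whose integer coefficients are alternating binomial sums.
  The symmetry \<open>f(-1 - z) = (-1)\<^sup>d f(z)\<close> makes \<open>h\<^sup>*\<close> palindromic, so only the \<open>m + 1\<close> forms with
  \<open>k \<le> m\<close> matter; they are positive multiples of the listed ones. The sign of \<open>a\<close> is forced by
  \<open>h\<^sup>*\<^sub>0 = f(0)\<close>. As \<open>\<Sum>\<^sub>k h\<^sup>*\<^sub>k\<close> equals \<open>d!\<close> times the leading coefficient, the normalised numbers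
  \<open>h\<^sup>*\<^sub>k + h\<^sup>*\<^sub>d\<^sub>-\<^sub>k\<close> (and \<open>h\<^sup>*\<^sub>k\<close> if \<open>2k = d\<close>) are the barycentric coordinates of \<open>v\<close> with respect to the
  listed points, the \<open>k\<close>-th of which is the \<open>v\<close> of the polynomial with \<open>h\<^sup>*(t)\<close> proportional to
  \<open>t\<^sup>k + t\<^sup>d\<^sup>-\<^sup>k\<close>.
\<close>

section \<open>Coefficients of the numerator, and palindromicity\<close>

lemma fps_nth_one_minus_X_power:
  "fps_nth ((1 - fps_X) ^ n :: real fps) j = (-1) ^ j * real (n choose j)"
proof -
  have "fps_of_poly [:1, -1:] = (1 - fps_X :: real fps)"
    by (rule fps_ext) (auto simp: coeff_pCons fps_X_def split: nat.splits)
  then have "fps_nth ((1 - fps_X) ^ n) j = coeff ([:1, -1:] ^ n :: real poly) j"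
    by (metis fps_of_poly_nth fps_of_poly_power)
  then show ?thesis
    by (cases "j \<le> n") (simp_all add: coeff_linear_poly_power coeff_eq_0 degree_power_eq)
qed

lemma coeff_hstar_poly:
  fixes f :: "real poly"
  shows "coeff (hstar_poly f) k =
    (\<Sum>j\<le>k. (-1) ^ j * real (Suc (degree f) choose j) * poly f (real (k - j)))"
proof -
  define u :: "real fps" where "u = (1 - fps_X) ^ (degree f + 1)"
  have u: "fps_nth u 0 \<noteq> 0"
    by (simp add: u_def fps_nth_power_0)
  have "Abs_fps (\<lambda>k. poly f (of_nat k)) = fps_of_poly (hstar_poly f) / u"
    using theI'[OF hstar_poly_ex1[of f]] by (simp add: hstar_poly_def u_def)
  then have "fps_of_poly (hstar_poly f) = u * Abs_fps (\<lambda>k. poly f (of_nat k))"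
    using u by (simp add: fps_divide_unit mult.left_commute[of u] inverse_mult_eq_1' )
  then have "coeff (hstar_poly f) k = fps_nth (u * Abs_fps (\<lambda>k. poly f (of_nat k))) k"
    by (metis fps_of_poly_nth)
  then show ?thesis
    by (simp add: fps_mult_nth u_def fps_nth_one_minus_X_power atLeast0AtMost
        del: power_Suc)
qed

text \<open>An \<open>n\<close>-th finite difference kills degrees below \<open>n\<close>. In terms
  of generating functions, the numerator over \<open>(1 - t)^n\<close> has degree below
  \<open>n\<close>, so its coefficient at \<open>t^n\<close> vanishes.\<close>

lemma sum_alternating_binomial_poly_eq_0:
  fixes p :: "real poly"
  assumes "degree p < n"
  shows "(\<Sum>j\<le>n. (-1) ^ j * real (n choose j) * poly p (x - real j)) = 0"
proof -
  \<comment> \<open>The translation makes \<open>q\<close> at \<open>n - j\<close> equal to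
    \<open>p\<close> at \<open>x - j\<close>.\<close>
  define q where "q = pcompose p [:x - real n, 1:]"
  have "degree q \<le> n - 1"
    using assms by (simp add: q_def degree_pcompose)
  then obtain h where h: "degree h \<le> n - 1"
    "fps_of_poly h = Abs_fps (\<lambda>k. poly q (of_nat k)) * (1 - fps_X) ^ n"
    using hstar_exists_aux[of q "n - 1"] assms by auto
  have "0 = fps_nth ((1 - fps_X) ^ n * Abs_fps (\<lambda>k. poly q (of_nat k))) n"
    using h(1) assms by (subst mult.commute, subst h(2)[symmetric]) (simp add: coeff_eq_0)
  also have "\<dots> = (\<Sum>j\<le>n. (-1) ^ j * real (n choose j) * poly p (x - real j))"
    by (simp add: fps_mult_nth fps_nth_one_minus_X_power atLeast0AtMost q_def poly_pcompose
        of_nat_diff algebra_simps)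
  finally show ?thesis by simp
qed

text \<open>Extending the sum for the \<open>k\<close>-th coefficient to all
  \<open>j \<le> degree f + 1\<close> gives a vanishing finite difference. Its terms with
  \<open>j > k\<close> evaluate \<open>f\<close> at negative integers, and the symmetry turns them
  into minus the sum for \<open>degree f - k\<close>.\<close>

lemma coeff_hstar_poly_palindromic:
  fixes f :: "real poly"
  assumes sym: "\<And>x. poly f (- 1 - x) = (-1) ^ degree f * poly f x" and k: "k \<le> degree f"
  shows "coeff (hstar_poly f) k = coeff (hstar_poly f) (degree f - k)"
proof -
  define d where "d = degree f"
  \<comment> \<open>The subtraction is real, since truncated subtraction would lose the negative
    arguments.\<close>
  define g where "g j = (-1) ^ j * real (Suc d choose j) * poly f (real k - real j)" for j
  have "0 = (\<Sum>j\<le>Suc d. g j)"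
    using sum_alternating_binomial_poly_eq_0[of f "Suc d" "real k"] by (simp add: d_def g_def)
  also have "\<dots> = (\<Sum>j\<le>k. g j) + (\<Sum>j\<in>{Suc k..Suc d}. g j)"
    using k by (subst sum.union_disjoint[symmetric])
      (auto simp: d_def simp del: sum.atMost_Suc intro!: sum.cong)
  also have "(\<Sum>j\<le>k. g j) = coeff (hstar_poly f) k"
    by (simp add: coeff_hstar_poly g_def d_def of_nat_diff)
  also have "(\<Sum>j\<in>{Suc k..Suc d}. g j) = (\<Sum>i\<le>d - k. g (Suc d - i))"
    using k by (intro sum.reindex_bij_witness[of _ "\<lambda>i. Suc d - i" "\<lambda>i. Suc d - i"])
      (auto simp: d_def)
  also have "\<dots> = - (\<Sum>i\<le>d - k. (-1) ^ i * real (Suc d choose i) * poly f (real (d - k - i)))"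
    unfolding sum_negf[symmetric]
  proof (rule sum.cong[OF refl])
    fix i assume "i \<in> {..d - k}"
    then have i: "i \<le> d - k" "i \<le> Suc d" by auto
    have "real k - real (Suc d - i) = - 1 - real (d - k - i)"
      using i k by (simp add: d_def of_nat_diff)
    then have "poly f (real k - real (Suc d - i)) = (-1) ^ d * poly f (real (d - k - i))"
      by (simp only: sym d_def)
    moreover have "(-1 :: real) ^ (Suc d - i) * ((-1) ^ d * y) = - ((-1) ^ i * y)" for y
      using i by (simp add: minus_one_power_iff)
    moreover have "Suc d choose (Suc d - i) = Suc d choose i"
      using i by (metis binomial_symmetric)
    ultimately show "g (Suc d - i) = - ((-1) ^ i * real (Suc d choose i) * poly f (real (d - k - i)))"
      by (simp only: g_def mult.assoc mult.left_commute[of "real _"])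
  qed
  also have "\<dots> = - coeff (hstar_poly f) (d - k)"
    by (simp add: coeff_hstar_poly d_def)
  finally show ?thesis by (simp add: d_def)
qed

section \<open>Expansion of CL-polynomials in elementary symmetric values\<close>

lemma elem_sym_0: "elem_sym m c 0 = 1"
proof -
  have "{S. S \<subseteq> {..<m} \<and> card S = 0} = {{}}"
    using finite_subset by fastforce
  then show ?thesis by (simp add: elem_sym_def)
qed

text \<open>Expand over the set \<open>S\<close> of factors that contribute \<open>c i\<close>, then
  group by \<open>card S\<close>.\<close>

lemma prod_add_eq_sum_elem_sym:
  "(\<Prod>i<m. x + c i) = (\<Sum>l\<le>m. elem_sym m c l * x ^ (m - l))"
proof -
  have "(\<Prod>i<m. c i + x) = (\<Sum>S\<in>Pow {..<m}. (\<Prod>i\<in>S. c i) * (\<Prod>i\<in>{..<m} - S. x))"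
    by (rule prod_add) simp
  also have "\<dots> = (\<Sum>S\<in>Pow {..<m}. (\<Prod>i\<in>S. c i) * x ^ (m - card S))"
    by (intro sum.cong refl) (auto simp: card_Diff_subset finite_subset)
  also have "\<dots> = (\<Sum>l\<le>m. \<Sum>S | S \<in> Pow {..<m} \<and> card S = l. (\<Prod>i\<in>S. c i) * x ^ (m - card S))"
    by (rule sum.group[symmetric]) (auto dest: card_mono[OF finite_lessThan])
  also have "\<dots> = (\<Sum>l\<le>m. elem_sym m c l * x ^ (m - l))"
    unfolding elem_sym_def sum_distrib_right by (intro sum.cong) auto
  finally show ?thesis by (simp add: add.commute)
qed

lemma poly_cl_poly:
  "poly (cl_poly d a c) x = a * (if even d then 1 else 2 * x + 1) *
     (\<Sum>l\<le>d div 2. elem_sym (d div 2) c l * (x * (x + 1)) ^ (d div 2 - l))"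
proof -
  have "poly (cl_poly d a c) x =
      a * (if even d then 1 else 2 * x + 1) * (\<Prod>i<d div 2. x * (x + 1) + c i)"
    by (auto simp: cl_poly_def poly_prod algebra_simps)
  then show ?thesis by (simp only: prod_add_eq_sum_elem_sym)
qed

lemma degree_cl_poly:
  assumes "a \<noteq> 0"
  shows "degree (cl_poly d a c) = d"
proof -
  have "degree (\<Prod>i<d div 2. [:c i, 1, 1:]) = (\<Sum>i<d div 2. degree [:c i, 1, 1:])"
    by (rule degree_prod_eq_sum_degree) simp
  moreover have "(\<Prod>i<d div 2. [:c i, 1, 1:]) \<noteq> 0" by simp
  ultimately show ?thesis
    using assms unfolding cl_poly_def by (subst degree_mult_eq) (auto, presburger)
qed

text \<open>
  The coefficient of \<open>t\<^sup>k\<close> in the numerator of the generating function of \<open>b(z) (z\<^sup>2 + z)\<^sup>q\<close> (with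
  \<open>a = 1\<close>) over \<open>(1 - t)\<^sup>d\<^sup>+\<^sup>1\<close>, where \<open>d\<close> need not be the degree of that polynomial.
\<close>

definition hstar_weight :: "nat \<Rightarrow> nat \<Rightarrow> nat \<Rightarrow> int" where
  "hstar_weight d k q = (\<Sum>j\<leftarrow>[0..<Suc k].
     (-1) ^ j * int (Suc d choose j) * (if even d then 1 else 2 * int (k - j) + 1) *
     (int (k - j) * (int (k - j) + 1)) ^ q)"

lemma coeff_hstar_cl_poly:
  assumes "a \<noteq> 0"
  shows "coeff (hstar_poly (cl_poly d a c)) k =
    a * (\<Sum>l\<le>d div 2. of_int (hstar_weight d k (d div 2 - l)) * elem_sym (d div 2) c l)"
proof -
  let ?m = "d div 2"
  define w :: "nat \<Rightarrow> real" where
    "w j = (-1) ^ j * real (Suc d choose j) * (if even d then 1 else 2 * real (k - j) + 1)" for j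
  have "real_of_int (hstar_weight d k q) =
      (\<Sum>j\<le>k. w j * (real (k - j) * (real (k - j) + 1)) ^ q)" for q
    unfolding hstar_weight_def interv_sum_list_conv_sum_set_nat w_def
    by (cases "even d")
      (simp_all add: lessThan_Suc_atMost atLeast0LessThan del: upt_Suc binomial_Suc_Suc)
  then have "a * (\<Sum>l\<le>?m. of_int (hstar_weight d k (?m - l)) * elem_sym ?m c l) =
      (\<Sum>l\<le>?m. \<Sum>j\<le>k. a * w j * (elem_sym ?m c l * (real (k - j) * (real (k - j) + 1)) ^ (?m - l)))"
    by (simp add: sum_distrib_left sum_distrib_right mult_ac)
  also have "\<dots> = coeff (hstar_poly (cl_poly d a c)) k"
    unfolding coeff_hstar_poly degree_cl_poly[OF assms] poly_cl_poly w_def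
    by (subst sum.swap) (simp only: mult.assoc mult.left_commute[of _ a] flip: sum_distrib_left)
  finally show ?thesis ..
qed

section \<open>Reduction to half of the coefficients\<close>

lemma diamond_cl_poly_iff:
  assumes a: "a \<noteq> 0" and c: "\<And>i. i < d div 2 \<Longrightarrow> 0 < c i"
  shows "diamond (cl_poly d a c) \<longleftrightarrow> 0 < a \<and>
    (\<forall>k\<in>{..d div 2}. 0 \<le> (\<Sum>l\<le>d div 2.
      of_int (hstar_weight d k (d div 2 - l)) * elem_sym (d div 2) c l))"
    (is "?D \<longleftrightarrow> 0 < a \<and> (\<forall>k\<in>_. 0 \<le> ?S k)")
proof -
  let ?h = "\<lambda>k. coeff (hstar_poly (cl_poly d a c)) k"
  have deg: "degree (cl_poly d a c) = d" using a by (rule degree_cl_poly)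
  have h: "?h k = a * ?S k" for k using a by (rule coeff_hstar_cl_poly)
  have "poly (cl_poly d a c) (- 1 - x) = (-1) ^ d * poly (cl_poly d a c) x" for x
  proof -
    \<comment> \<open>The reflection fixes \<open>x * (x + 1)\<close>; only the factor present for
      odd \<open>d\<close> changes sign.\<close>
    have "(- 1 - x) * (- 1 - x + 1) = x * (x + 1)" by (simp add: algebra_simps)
    moreover have "2 * (- 1 - x) + 1 = - (2 * x + 1)" by simp
    ultimately show ?thesis by (cases "even d")
      (simp_all only: poly_cl_poly if_True if_False uminus_power_if power_one mult_1
        mult_minus_left mult_minus_right)
  qed
  then have pal: "?h k = ?h (d - k)" if "k \<le> d" for k
    using coeff_hstar_poly_palindromic[of "cl_poly d a c" k] that by (simp add: deg)
  have D: "?D \<longleftrightarrow> (\<forall>k\<le>d div 2. 0 \<le> a * ?S k)"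
  proof
    assume "\<forall>k\<le>d div 2. 0 \<le> a * ?S k"
    then have half: "0 \<le> ?h k" if "k \<le> d div 2" for k using that by (simp add: h)
    have "0 \<le> ?h k" if "k \<le> d" for k
    proof (cases "k \<le> d div 2")
      case False
      then have "d - k \<le> d div 2" by presburger
      then show ?thesis using half pal[OF that] by simp
    qed (rule half)
    then show ?D unfolding diamond_def deg using pal by blast
  qed (auto simp: diamond_def deg h)
  have "?h 0 = a * (\<Prod>i<d div 2. c i)"
    by (simp add: coeff_hstar_poly cl_poly_def poly_prod)
  \<comment> \<open>For \<open>k = 0\<close> only the value at 0 enters; as every \<open>c i\<close>
    is positive, it is nonzero with the sign of \<open>a\<close>.\<close>
  moreover have "0 < (\<Prod>i<d div 2. c i)" using c by (intro prod_pos) auto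
  moreover have "0 \<le> ?h 0" if ?D using that unfolding diamond_def by blast
  ultimately have "0 < a" if ?D
    using that a by (simp add: zero_le_mult_iff)
  then show ?thesis by (auto simp: D zero_le_mult_iff)
qed

section \<open>Barycentric coordinates\<close>

text \<open>Dividing by the total \<open>t\<close> normalises the weights. Lists let explicit sums
  be evaluated by rewriting.\<close>

lemma weighted_sum_list_in_convex_hull:
  fixes ps :: "'a :: real_vector list"
  assumes "length ws = length ps" and "\<And>w. w \<in> set ws \<Longrightarrow> 0 \<le> w"
    and "sum_list ws = t" and "0 < t" and "sum_list (map2 (*\<^sub>R) ws ps) = t *\<^sub>R v"
  shows "v \<in> convex hull set ps"
proof -
  have "(\<Sum>i<length ps. (ws ! i / t) *\<^sub>R (ps ! i)) \<in> convex hull set ps"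
    using assms
    by (intro convex_sum)
      (auto simp: sum_list_sum_nth atLeast0LessThan intro!: hull_inc simp flip: sum_divide_distrib)
  also have "(\<Sum>i<length ps. (ws ! i / t) *\<^sub>R (ps ! i)) = (1 / t) *\<^sub>R sum_list (map2 (*\<^sub>R) ws ps)"
    using assms(1) by (simp add: sum_list_sum_nth atLeast0LessThan scaleR_sum_right)
  also have "\<dots> = v" using assms(4,5) by simp
  finally show ?thesis .
qed

text \<open>At \<open>e = elem_sym (d div 2) c\<close> this is the coefficient of \<open>t^k\<close>
  divided by \<open>a\<close>. An abstract \<open>e\<close> keeps the symmetric values atomic for
  linear arithmetic.\<close>

definition hstar_form :: "nat \<Rightarrow> (nat \<Rightarrow> real) \<Rightarrow> nat \<Rightarrow> real" where
  "hstar_form d e k = (\<Sum>l\<le>d div 2. of_int (hstar_weight d k (d div 2 - l)) * e l)"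

text \<open>The factor 2 merges the equal coefficients at \<open>k\<close> and \<open>d - k\<close>;
  a middle one counts once.\<close>

definition barycentric_weight :: "nat \<Rightarrow> (nat \<Rightarrow> real) \<Rightarrow> nat \<Rightarrow> real" where
  "barycentric_weight d e k = (if 2 * k = d then 1 else 2) * hstar_form d e k"

text \<open>\<open>P\<close> comes first so that resolution can find \<open>ps\<close> before the
  other premises are evaluated. In \<open>one\<close>, the factor 2 for odd \<open>d\<close> is the
  leading coefficient of \<open>2z + 1\<close>.\<close>

lemma diamond_cl_poly_simplex:
  fixes P :: "'a :: real_vector set"
  assumes P: "set ps = P"
    and a: "a \<noteq> 0" and c: "\<forall>i<d div 2. 0 < c i"
    and e: "e = elem_sym (d div 2) c"
    and len: "length ps = Suc (d div 2)"
    and Q: "(\<forall>k\<in>{..d div 2}. 0 \<le> hstar_form d e k) \<longleftrightarrow> Q"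
    and one: "(\<Sum>k\<leftarrow>[0..<Suc (d div 2)]. barycentric_weight d e k) =
      (if even d then 1 else 2) * fact d"
    and v: "sum_list (map2 (*\<^sub>R) (map (barycentric_weight d e) [0..<Suc (d div 2)]) ps) =
      ((if even d then 1 else 2) * fact d) *\<^sub>R v"
  shows "(diamond (cl_poly d a c) \<longleftrightarrow> 0 < a \<and> Q) \<and>
    (diamond (cl_poly d a c) \<longrightarrow> v \<in> convex hull P)"
proof -
  have D: "diamond (cl_poly d a c) \<longleftrightarrow> 0 < a \<and> (\<forall>k\<in>{..d div 2}. 0 \<le> hstar_form d e k)"
    using diamond_cl_poly_iff[OF a, of d c] c by (simp add: hstar_form_def e)
  have "v \<in> convex hull P" if "\<forall>k\<in>{..d div 2}. 0 \<le> hstar_form d e k"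
    unfolding P[symmetric]
  proof (rule weighted_sum_list_in_convex_hull[OF _ _ one _ v])
    fix w assume "w \<in> set (map (barycentric_weight d e) [0..<Suc (d div 2)])"
    then show "0 \<le> w" using that by (auto simp: barycentric_weight_def less_Suc_eq_le)
  qed (use len in simp_all)
  with D Q show ?thesis by simp
qed

section \<open>Evaluation of the eleven degrees\<close>

text \<open>Reads a list off a displayed set in the displayed order, so that the \<open>k\<close>-th
  weight meets the \<open>k\<close>-th point.\<close>

lemma set_Cons_eqI: "set xs = A \<Longrightarrow> set (x # xs) = insert x A"
  by simp

lemmas interval_eval = upt_rec atMost_nat_numeral atMost_Suc

lemmas hstar_form_eval =
  interval_eval barycentric_weight_def hstar_form_def hstar_weight_def choose_reduce_nat
  fact_numeral

theorem mainTheorem4: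
  fixes d :: nat and a :: real and c :: "nat \<Rightarrow> real" and f :: "real poly"
    and e :: "nat \<Rightarrow> real"
  assumes "4 \<le> d" and "d \<le> 14"
    and "a \<noteq> 0" and "\<And>i. i < d div 2 \<Longrightarrow> 1 / 4 \<le> c i"
    and "f = cl_poly d a c"
    and "\<And>l. e l = elem_sym (d div 2) c l"
  shows "(d = 4 \<longrightarrow> (let v = (e 1, e 2) in
      (diamond f \<longleftrightarrow> 0 < a
        \<and> (0, 1) \<bullet> v \<ge> 0
        \<and> (1, -2) \<bullet> v + 2 \<ge> 0
        \<and> (-2, 3) \<bullet> v + 8 \<ge> 0)
      \<and> (diamond f \<longrightarrow> v \<in> convex hull
          {(22, 12),
           (4, 0),
           (-2, 0)}))) \<and>
    (d = 5 \<longrightarrow> (let v = (e 1, e 2) in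
      (diamond f \<longleftrightarrow> 0 < a
        \<and> (0, 1) \<bullet> v \<ge> 0
        \<and> (2, -1) \<bullet> v + 4 \<ge> 0
        \<and> (-3, 1) \<bullet> v + 54 \<ge> 0)
      \<and> (diamond f \<longrightarrow> v \<in> convex hull
          {(58, 120),
           (18, 0),
           (-2, 0)}))) \<and>
    (d = 6 \<longrightarrow> (let v = (e 1, e 2, e 3) in
      (diamond f \<longleftrightarrow> 0 < a
        \<and> (0, 0, 1) \<bullet> v \<ge> 0
        \<and> (2, 1, -3) \<bullet> v + 4 \<ge> 0
        \<and> (8, -8, 15) \<bullet> v + 160 \<ge> 0
        \<and> (-6, 3, -5) \<bullet> v + 96 \<ge> 0)
      \<and> (diamond f \<longrightarrow> v \<in> convex hull
          {(127, 822, 360),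
           (52, 72, 0),
           (7, -18, 0),
           (-8, 12, 0)}))) \<and>
    (d = 7 \<longrightarrow> (let v = (e 1, e 2, e 3) in
      (diamond f \<longleftrightarrow> 0 < a
        \<and> (0, 0, 1) \<bullet> v \<ge> 0
        \<and> (12, 6, -5) \<bullet> v + 24 \<ge> 0
        \<and> (28, -6, 3) \<bullet> v + 296 \<ge> 0
        \<and> (-96, 12, -5) \<bullet> v + 4128 \<ge> 0)
      \<and> (diamond f \<longrightarrow> v \<in> convex hull
          {(244, 3708, 5040),
           (118, 600, 0),
           (34, -72, 0),
           (-8, 12, 0)}))) \<and>
    (d = 8 \<longrightarrow> (let v = (e 1, e 2, e 3, e 4) in
      (diamond f \<longleftrightarrow> 0 < a
        \<and> (0, 0, 0, 1) \<bullet> v \<ge> 0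
        \<and> (4, 2, 1, -4) \<bullet> v + 8 \<ge> 0
        \<and> (36, 0, -3, 7) \<bullet> v + 288 \<ge> 0
        \<and> (36, -18, 15, -28) \<bullet> v + 4824 \<ge> 0
        \<and> (-224, 32, -20, 35) \<bullet> v + 9344 \<ge> 0)
      \<and> (diamond f \<longrightarrow> v \<in> convex hull
          {(428, 13324, 52272, 20160),
           (232, 3132, 2880, 0),
           (92, 52, -480, 0),
           (8, -116, 192, 0),
           (-20, 108, -144, 0)}))) \<and>
    (d = 9 \<longrightarrow> (let v = (e 1, e 2, e 3, e 4) in
      (diamond f \<longleftrightarrow> 0 < a
        \<and> (0, 0, 0, 1) \<bullet> v \<ge> 0
        \<and> (24, 12, 6, -7) \<bullet> v + 48 \<ge> 0
        \<and> (84, 6, -3, 2) \<bullet> v + 600 \<ge> 0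
        \<and> (1188, -126, 27, -14) \<bullet> v + 41256 \<ge> 0
        \<and> (-1620, 90, -15, 7) \<bullet> v + 137160 \<ge> 0)
      \<and> (diamond f \<longrightarrow> v \<in> convex hull
          {(700, 39708, 341136, 362880),
           (412, 11772, 35280, 0),
           (196, 1404, -3600, 0),
           (52, -468, 720, 0),
           (-20, 108, -144, 0)}))) \<and>
    (d = 10 \<longrightarrow> (let v = (e 1, e 2, e 3, e 4, e 5) in
      (diamond f \<longleftrightarrow> 0 < a
        \<and> (0, 0, 0, 0, 1) \<bullet> v \<ge> 0
        \<and> (8, 4, 2, 1, -5) \<bullet> v + 16 \<ge> 0
        \<and> (1120, 128, -8, -16, 45) \<bullet> v + 7424 \<ge> 0
        \<and> (920, -26, -4, 7, -15) \<bullet> v + 20632 \<ge> 0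
        \<and> (272, -224, 68, -56, 105) \<bullet> v + 442624 \<ge> 0
        \<and> (-4520, 260, -50, 35, -63) \<bullet> v + 378320 \<ge> 0)
      \<and> (diamond f \<longrightarrow> v \<in> convex hull
          {(1085, 104008, 1757196, 5132880, 1814400),
           (680, 36508, 277056, 201600, 0),
           (365, 7528, -3924, -25200, 0),
           (140, -572, -3024, 7200, 0),
           (5, -392, 2556, -3600, 0),
           (-40, 508, -2304, 2880, 0)}))) \<and>
    (d = 11 \<longrightarrow> (let v = (e 1, e 2, e 3, e 4, e 5) in
      (diamond f \<longleftrightarrow> 0 < a
        \<and> (0, 0, 0, 0, 1) \<bullet> v \<ge> 0
        \<and> (16, 8, 4, 2, -3) \<bullet> v + 32 \<ge> 0
        \<and> (5904, 792, 36, -42, 35) \<bullet> v + 37728 \<ge> 0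
        \<and> (4704, 48, -24, 8, -5) \<bullet> v + 85440 \<ge> 0
        \<and> (19216, -1192, 124, -28, 15) \<bullet> v + 1740512 \<ge> 0
        \<and> (-31968, 936, -72, 14, -7) \<bullet> v + 4692384 \<ge> 0)
      \<and> (diamond f \<longrightarrow> v \<in> convex hull
          {(1610, 244708, 7272216, 44339040, 39916800),
           (1060, 97308, 1494576, 3265920, 0),
           (620, 26908, 84816, -282240, 0),
           (290, 1828, -30024, 50400, 0),
           (70, -1692, 9576, -12960, 0),
           (-40, 508, -2304, 2880, 0)}))) \<and>
    (d = 12 \<longrightarrow> (let v = (e 1, e 2, e 3, e 4, e 5, e 6) in
      (diamond f \<longleftrightarrow> 0 < a
        \<and> (0, 0, 0, 0, 0, 1) \<bullet> v \<ge> 0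
        \<and> (16, 8, 4, 2, 1, -6) \<bullet> v + 32 \<ge> 0
        \<and> (3680, 544, 56, -8, -10, 33) \<bullet> v + 22912 \<ge> 0
        \<and> (75120, 2568, -228, -6, 45, -110) \<bullet> v + 1192224 \<ge> 0
        \<and> (187520, -4352, 32, 64, -80, 165) \<bullet> v + 9601024 \<ge> 0
        \<and> (-7680, -984, 144, -42, 35, -66) \<bullet> v + 9717408 \<ge> 0
        \<and> (-104672, 3104, -248, 56, -42, 77) \<bullet> v + 15276416 \<ge> 0)
      \<and> (diamond f \<longrightarrow> v \<in> convex hull
          {(2306, 530368, 25971144, 302788656, 723263040, 239500800),
           (1580, 232708, 6523056, 34999200, 21772800, 0),
           (986, 78268, 804024, -840384, -2177280, 0),
           (524, 13588, -95952, -108576, 483840, 0),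
           (194, -2912, -2232, 105264, -181440, 0),
           (-4, -932, 15984, -80064, 103680, 0),
           (-70, 1708, -17544, 72000, -86400, 0)}))) \<and>
    (d = 13 \<longrightarrow> (let v = (e 1, e 2, e 3, e 4, e 5, e 6) in
      (diamond f \<longleftrightarrow> 0 < a
        \<and> (0, 0, 0, 0, 0, 1) \<bullet> v \<ge> 0
        \<and> (96, 48, 24, 12, 6, -11) \<bullet> v + 192 \<ge> 0
        \<and> (6256, 968, 124, 2, -9, 9) \<bullet> v + 38432 \<ge> 0
        \<and> (86160, 4200, -60, -30, 15, -11) \<bullet> v + 1260960 \<ge> 0
        \<and> (1583520, -3984, -1560, 300, -90, 55) \<bullet> v + 60906432 \<ge> 0
        \<and> (2849920, -117280, 6880, -760, 180, -99) \<bullet> v + 590783360 \<ge> 0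
        \<and> (-1475936, 25592, -1064, 98, -21, 11) \<bullet> v + 344354528 \<ge> 0)
      \<and> (diamond f \<longrightarrow> v \<in> convex hull
          {(3206, 1071868, 81406344, 1627117056, 7827719040, 6227020800),
           (2270, 508708, 23753736, 249815520, 439084800, 0),
           (1490, 196708, 4275576, 6979680, -32659200, 0),
           (866, 50068, -22536, -2702304, 5080320, 0),
           (398, 148, -123000, 847008, -1209600, 0),
           (86, -4532, 61704, -287424, 362880, 0),
           (-70, 1708, -17544, 72000, -86400, 0)}))) \<and>
    (d = 14 \<longrightarrow> (let v = (e 1, e 2, e 3, e 4, e 5, e 6, e 7) in
      (diamond f \<longleftrightarrow> 0 < a
        \<and> (0, 0, 0, 0, 0, 0, 1) \<bullet> v \<ge> 0
        \<and> (32, 16, 8, 4, 2, 1, -7) \<bullet> v + 64 \<ge> 0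
        \<and> (45696, 7296, 1056, 96, -24, -24, 91) \<bullet> v + 278016 \<ge> 0
        \<and> (573216, 33888, 744, -168, 6, 33, -91) \<bullet> v + 7911552 \<ge> 0
        \<and> (24080000, 269440, -22240, 1120, 200, -440, 1001) \<bullet> v + 771857920 \<ge> 0
        \<and> (30693600, -533520, 9720, 540, -450, 495, -1001) \<bullet> v + 3152571840 \<ge> 0
        \<and> (-7032576, -169728, 15936, -2112, 624, -528, 1001) \<bullet> v + 6989196288 \<ge> 0
        \<and> (-5559008, 96992, -4088, 392, -98, 77, -143) \<bullet> v + 1292719232 \<ge> 0)
      \<and> (diamond f \<longrightarrow> v \<in> convex hull
          {(4347, 2046870, 231190132, 7475341368, 67360465152, 138619313280, 43589145600),
           (3164, 1036588, 76136688, 1431621504, 6044647680, 3353011200, 0),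
           (2163, 445998, 17610220, 114649848, -163634400, -279417600, 0),
           (1344, 142968, 1436608, -15125616, -2062080, 50803200, 0),
           (707, 19390, -492228, 1431288, 6560352, -15240960, 0),
           (252, -8820, 51952, 524928, -4578048, 6773760, 0),
           (-21, -1722, 66148, -787656, 3441600, -4233600, 0),
           (-112, 4648, -89280, 808848, -3110400, 3628800, 0)})))"
proof -
  \<comment> \<open>Makes the summand \<open>l = 0\<close> the constant term of each affine
    form.\<close>
  have e0: "e 0 = 1" by (simp add: assms(6) elem_sym_0)
  have e: "e = elem_sym (d div 2) c" using assms(6) by blast
  have c: "\<forall>i<d div 2. 0 < c i" using assms(4) by fastforce
  \<comment> \<open>Besides the length of \<open>ps\<close>, each degree leaves \<open>Q\<close>,
    \<open>one\<close> and \<open>v\<close>, which are linear in the \<open>e l\<close> once the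
    weights are numbers.\<close>
  note simplex = diamond_cl_poly_simplex[OF _ assms(3) c e, folded assms(5)]
  \<comment> \<open>The ranges of \<open>k\<close> are enumerated first: \<open>upt_rec\<close> would loop on the interval in \<open>hstar_weight_def\<close>
    as long as \<open>k\<close> is a bound variable.\<close>
  show ?thesis
    by (intro conjI impI; unfold Let_def; (rule simplex, (rule set_Cons_eqI list.set(1))+);
        simp add: interval_eval; simp add: hstar_form_eval e0; safe?; linarith)
qed

end
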